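(* For every integer $d\ge 2$, the critical value of the $\mathrm{GN}_1(d,\alpha)$ model satisfies $\alpha_c(d)<\infty$.
   Context: Let $X$ be a homogeneous Poisson process on $\mathbb{R}^d$ (of some positive, finite density; the choice of density only rescales the model). For $x\in X$ let $d_1(x)$ be the Euclidean distance from $x$ to its nearest neighbour among the other points of $X$. For a real $\alpha\ge 0$, the model $\mathrm{GN}_1(d,\alpha)$ is the random undirected graph with vertex set $X$ in which each $x\in X$ is joined by an edge to every $y\in X$ with $y\ne x$ and $|x-y|\le r(x)$, where $r(x)=\alpha d_1(x)$ (so $x,y$ are adjacent iff $|x-y|\le r(x)$ or $|x-y|\le r(y)$). Let $U$ be the event that the graph has an infinite connected component. The critical value is $\alpha_c(d)=\inf\{\alpha\ge 0:\mathbb{P}(U)>0\}$ (with $\inf\emptyset=\infty$), where $\mathbb{P}(U)$ is computed in $\mathrm{GN}_1(d,\alpha)$. *)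

theory Defs
  imports "HOL-Probability.Probability"
begin

text \<open>A simple point process is a random locally finite set; local finiteness is required of
  every realisation. Counts are taken in bounded Borel sets only, so they are always genuine
  natural numbers. The Poisson probabilities are written out, rather than taken from the library's
  \<open>poisson_pmf\<close>, because the mean may be zero (with \<open>0 ^ 0 = 1\<close>), which
  \<open>poisson_pmf\<close> excludes.\<close>

locale homogeneous_poisson_process = prob_space M
  for M :: "'w measure" and density :: real and X :: "'w \<Rightarrow> 'a::euclidean_space set" +
  assumes density_pos: "0 < density"
    and locally_finite:
      "\<And>\<omega> B. \<lbrakk>\<omega> \<in> space M; bounded B\<rbrakk> \<Longrightarrow> finite (X \<omega> \<inter> B)"
    and count_measurable:
      "\<And>B. \<lbrakk>B \<in> sets borel; bounded B\<rbrakk> \<Longrightarrow>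
        random_variable (count_space UNIV) (\<lambda>\<omega>. card (X \<omega> \<inter> B))"
    and count_poisson:
      "\<And>B k. \<lbrakk>B \<in> sets borel; bounded B\<rbrakk> \<Longrightarrow>
        prob {\<omega> \<in> space M. card (X \<omega> \<inter> B) = k} =
          (density * measure lborel B) ^ k / fact k * exp (- (density * measure lborel B))"
    and count_indep:
      "\<And>B n. \<lbrakk>\<And>i. i < n \<Longrightarrow> B i \<in> sets borel \<and> bounded (B i);
        disjoint_family_on B {..<n}\<rbrakk> \<Longrightarrow>
        indep_vars (\<lambda>_. count_space UNIV) (\<lambda>i \<omega>. card (X \<omega> \<inter> B i)) {..<n::nat}"

definition nn_dist :: "'a::metric_space set \<Rightarrow> 'a \<Rightarrow> real" where
  "nn_dist V x = infdist x (V - {x})"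

definition gn1_edges :: "real \<Rightarrow> 'a::metric_space set \<Rightarrow> ('a \<times> 'a) set" where
  "gn1_edges \<alpha> V = {(x, y). x \<in> V \<and> y \<in> V \<and> x \<noteq> y \<and>
     (dist x y \<le> \<alpha> * nn_dist V x \<or> dist x y \<le> \<alpha> * nn_dist V y)}"

definition component :: "('a \<times> 'a) set \<Rightarrow> 'a \<Rightarrow> 'a set" where
  "component E x = E\<^sup>* `` {x}"

definition has_infinite_component :: "'a set \<Rightarrow> ('a \<times> 'a) set \<Rightarrow> bool" where
  "has_infinite_component V E \<longleftrightarrow> (\<exists>x\<in>V. infinite (component E x))"

definition gn1_percolation_event ::
  "'w measure \<Rightarrow> ('w \<Rightarrow> 'a::metric_space set) \<Rightarrow> real \<Rightarrow> 'w set" where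
  "gn1_percolation_event M X \<alpha> =
     {\<omega> \<in> space M. has_infinite_component (X \<omega>) (gn1_edges \<alpha> (X \<omega>))}"

text \<open>The infimum is taken in the extended reals, where the infimum of the empty set is
  \<open>\<infinity>\<close>.\<close>

definition gn1_critical_value ::
  "'w measure \<Rightarrow> ('w \<Rightarrow> 'a::metric_space set) \<Rightarrow> ereal" where
  "gn1_critical_value M X =
     Inf {ereal \<alpha> | \<alpha>. 0 \<le> \<alpha> \<and> 0 < measure M (gn1_percolation_event M X \<alpha>)}"

end

theory Submission
  imports Defs
begin

text \<open>Group cells into blocks of \<open>N\<close> cells, called sites. A site is good when some cell of it has an
  isolated point, whose radius is then at least \<open>\<alpha>\<close>; so if \<open>\<alpha>\<close> exceeds the diameter of two
  neighbouring sites, the isolated points of neighbouring good sites are adjacent. For large \<open>N\<close>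
  sites are independently bad with arbitrarily small probability \<open>\<epsilon>\<close>. Percolation of good sites
  follows by renormalisation, without contour counting: a \<open>3 \<times> 3\<close> box of boxes is good if at most
  one of its subboxes is bad. Good subboxes of a good box, and of neighbouring good boxes, remain
  connected, while the probability of a bad box of level \<open>n\<close> is at most \<open>(81 \<epsilon>) ^ 2 ^ n\<close>, which is
  summable with sum less than 1.

  Since the process is only known through counts and the underlying space need not be
  complete, the measurability of the percolation event has to be shown as well.\<close>

subsection \<open>Renormalisation\<close>

text \<open>A box of level \<open>n\<close> is a \<open>3 ^ n\<close> by \<open>3 ^ n\<close> array of sites, indexed by its position among the
  boxes of that level.\<close>

definition subboxes :: "nat \<times> nat \<Rightarrow> (nat \<times> nat) set" where
  "subboxes p = {u. fst u div 3 = fst p \<and> snd u div 3 = snd p}"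

primrec bad_box :: "(nat \<times> nat \<Rightarrow> bool) \<Rightarrow> nat \<Rightarrow> nat \<times> nat \<Rightarrow> bool" where
  "bad_box b 0 p = b p"
| "bad_box b (Suc n) p =
     (\<exists>u\<in>subboxes p. \<exists>v\<in>subboxes p. u \<noteq> v \<and> bad_box b n u \<and> bad_box b n v)"

text \<open>Each element of \<open>bad_witnesses n p\<close> is a set of \<open>2 ^ n\<close> sites that, when all bad, force the box to
  be bad; counting these sets replaces an independence argument at every level.\<close>

primrec bad_witnesses :: "nat \<Rightarrow> nat \<times> nat \<Rightarrow> (nat \<times> nat) set set" where
  "bad_witnesses 0 p = {{p}}"
| "bad_witnesses (Suc n) p =
     {D \<union> D' | u v D D'. u \<in> subboxes p \<and> v \<in> subboxes p \<and> u \<noteq> v \<and>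
        D \<in> bad_witnesses n u \<and> D' \<in> bad_witnesses n v}"

section \<open>Witnesses of bad boxes and their number\<close>

lemma subboxes_eq:
  "subboxes p = (\<lambda>(s, t). (3 * fst p + s, 3 * snd p + t)) ` ({0, 1, 2} \<times> {0, 1, 2})"
proof -
  have *: "n div 3 = m \<longleftrightarrow> n = 3 * m \<or> n = 3 * m + 1 \<or> n = 3 * m + 2" for n m :: nat
    by presburger
  show ?thesis
    unfolding subboxes_def by (cases p) (simp add: * set_eq_iff, blast)
qed

lemma finite_subboxes: "finite (subboxes p)"
  by (simp add: subboxes_eq)

lemma card_subboxes_le: "card (subboxes p) \<le> 9"
  unfolding subboxes_eq by (rule order.trans[OF card_image_le]) auto

lemma bad_box_imp_witness:
  "bad_box b n p \<Longrightarrow> \<exists>D\<in>bad_witnesses n p. \<forall>q\<in>D. b q"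
proof (induction n arbitrary: p)
  case (Suc n)
  then obtain u v where uv: "u \<in> subboxes p" "v \<in> subboxes p" "u \<noteq> v"
      and "bad_box b n u" "bad_box b n v"
    by auto
  with Suc.IH obtain D D' where "D \<in> bad_witnesses n u" "D' \<in> bad_witnesses n v"
      and "\<forall>q\<in>D. b q" "\<forall>q\<in>D'. b q"
    by meson
  with uv have "D \<union> D' \<in> bad_witnesses (Suc n) p" "\<forall>q\<in>D \<union> D'. b q"
    by (auto simp del: split_paired_Ex)
  then show ?case by blast
qed auto

text \<open>Division by \<open>3 ^ n\<close> sends a site to its box of level \<open>n\<close>, so
  witnesses of distinct boxes of a level are disjoint.\<close>

lemma bad_witnesses_ancestor:
  "D \<in> bad_witnesses n p \<Longrightarrow> q \<in> D \<Longrightarrow> fst q div 3 ^ n = fst p \<and> snd q div 3 ^ n = snd p"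
proof (induction n arbitrary: p D q)
  case (Suc n)
  then obtain u D' where "u \<in> subboxes p" "D' \<in> bad_witnesses n u" "q \<in> D'"
    by auto
  moreover from Suc.IH[OF this(2,3)] have "fst q div 3 ^ n = fst u" "snd q div 3 ^ n = snd u"
    by auto
  ultimately show ?case
    by (simp add: subboxes_def power_Suc2 div_mult2_eq del: power_Suc)
qed auto

lemma bad_witnesses_card: "D \<in> bad_witnesses n p \<Longrightarrow> finite D \<and> card D = 2 ^ n"
proof (induction n arbitrary: p D)
  case (Suc n)
  from Suc.prems obtain u v D1 D2 where uv: "u \<noteq> v" and D: "D = D1 \<union> D2"
      and D12: "D1 \<in> bad_witnesses n u" "D2 \<in> bad_witnesses n v"
    unfolding bad_witnesses.simps by blast
  have "D1 \<inter> D2 = {}"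
    using bad_witnesses_ancestor[OF D12(1)] bad_witnesses_ancestor[OF D12(2)] uv
    by (metis disjoint_iff prod_eqI)
  with D Suc.IH[OF D12(1)] Suc.IH[OF D12(2)] show ?case
    by (simp add: card_Un_disjoint)
qed auto

text \<open>With at most \<open>9 * 9\<close> pairs of subboxes, the maximal count at a level is at
  most 81 times the square of that below; the factor 81 in the statement turns this recursion into
  plain squaring.\<close>

lemma finite_bad_witnesses_card_le:
  "finite (bad_witnesses n p) \<and> 81 * card (bad_witnesses n p) \<le> 81 ^ 2 ^ n"
proof (induction n arbitrary: p)
  case (Suc n)
  define P where "P = {(u, v). u \<in> subboxes p \<and> v \<in> subboxes p \<and> u \<noteq> v}"
  define W where "W = (\<lambda>(u, v). (\<lambda>(D, D'). D \<union> D') ` (bad_witnesses n u \<times> bad_witnesses n v))"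
  have P_sub: "P \<subseteq> subboxes p \<times> subboxes p"
    by (auto simp: P_def)
  then have fin_P: "finite P"
    using finite_subboxes finite_subset by blast
  have card_P: "card P \<le> 81"
  proof -
    have "card P \<le> card (subboxes p) * card (subboxes p)"
      using card_mono[OF _ P_sub] finite_subboxes by (simp add: card_cartesian_product)
    also have "\<dots> \<le> 9 * 9"
      by (intro mult_le_mono card_subboxes_le)
    finally show ?thesis by simp
  qed
  have W_eq: "bad_witnesses (Suc n) p = (\<Union>x\<in>P. W x)"
  proof (rule set_eqI)
    fix D
    have W_iff: "D \<in> W (u, v) \<longleftrightarrow> (\<exists>D1 D2. D1 \<in> bad_witnesses n u \<and> D2 \<in> bad_witnesses n v \<and> D = D1 \<union> D2)"
      for u v
      unfolding W_def by (simp add: image_iff Bex_def)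
    have P_iff: "(u, v) \<in> P \<longleftrightarrow> u \<in> subboxes p \<and> v \<in> subboxes p \<and> u \<noteq> v" for u v
      unfolding P_def by (simp del: prod.inject)
    have "D \<in> (\<Union>x\<in>P. W x) \<longleftrightarrow> (\<exists>u v. (u, v) \<in> P \<and> D \<in> W (u, v))"
      unfolding UN_iff Bex_def by (metis surj_pair)
    then show "D \<in> bad_witnesses (Suc n) p \<longleftrightarrow> D \<in> (\<Union>x\<in>P. W x)"
      unfolding bad_witnesses.simps P_iff W_iff by blast
  qed
  have fin_W: "finite (W x)" for x
    using Suc by (auto simp: W_def split: prod.splits)
  have card_W: "81 * 81 * card (W x) \<le> 81 ^ 2 ^ Suc n" for x
  proof -
    obtain u v where x: "x = (u, v)" by (cases x)
    have "card (W x) \<le> card (bad_witnesses n u) * card (bad_witnesses n v)"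
      unfolding x W_def prod.case card_cartesian_product[symmetric]
      by (rule card_image_le) (use Suc in auto)
    then have "81 * 81 * card (W x) \<le> (81 * card (bad_witnesses n u)) * (81 * card (bad_witnesses n v))"
      by simp
    also have "\<dots> \<le> 81 ^ 2 ^ n * 81 ^ 2 ^ n"
      using Suc by (intro mult_le_mono) auto
    finally show ?thesis
      by (simp add: mult_2 power_add)
  qed
  have fin: "finite (bad_witnesses (Suc n) p)"
    unfolding W_eq using fin_P fin_W by blast
  have "81 * (81 * card (\<Union>x\<in>P. W x)) \<le> (\<Sum>x\<in>P. 81 * 81 * card (W x))"
    using card_UN_le[OF fin_P, of W] by (simp add: sum_distrib_left[symmetric])
  also have "\<dots> \<le> card P * 81 ^ 2 ^ Suc n"
    using sum_bounded_above[of P "\<lambda>x. 81 * 81 * card (W x)" "81 ^ 2 ^ Suc n"] card_W by simp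
  also have "\<dots> \<le> 81 * 81 ^ 2 ^ Suc n"
    using card_P by simp
  finally have "81 * card (bad_witnesses (Suc n) p) \<le> 81 ^ 2 ^ Suc n"
    unfolding W_eq by simp
  with fin show ?case by blast
qed auto

lemmas finite_bad_witnesses = finite_bad_witnesses_card_le[THEN conjunct1]
  and card_bad_witnesses_le = finite_bad_witnesses_card_le[THEN conjunct2]

text \<open>A union bound over witnesses gives \<open>(81 * \<epsilon>) ^ 2 ^ n\<close> at level
  \<open>n\<close>. As \<open>324 = 4 * 81\<close>, this is at most \<open>(1/4) ^ Suc n\<close>,
  and all levels together contribute at most \<open>1/3\<close>.\<close>

lemma (in prob_space) all_boxes_good_outside_event:
  fixes b :: "'a \<Rightarrow> nat \<times> nat \<Rightarrow> bool" and \<epsilon> :: real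
  assumes meas: "\<And>q. {\<omega> \<in> space M. b \<omega> q} \<in> events"
    and bound: "\<And>D. finite D \<Longrightarrow> prob {\<omega> \<in> space M. \<forall>q\<in>D. b \<omega> q} \<le> \<epsilon> ^ card D"
    and eps: "0 \<le> \<epsilon>" "324 * \<epsilon> \<le> 1"
  obtains U where "U \<in> events" "prob U < 1"
    "\<And>\<omega> n. \<omega> \<in> space M - U \<Longrightarrow> \<not> bad_box (b \<omega>) n (0, 0)"
proof
  define F where "F D = {\<omega> \<in> space M. \<forall>q\<in>D. b \<omega> q}" for D
  define A where "A n = (\<Union>D\<in>bad_witnesses n (0, 0). F D)" for n
  have F: "F D \<in> events" if "finite D" for D
    unfolding F_def using that meas by (intro sets.sets_Collect_finite_All) auto
  have A: "A n \<in> events" for n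
    unfolding A_def using finite_bad_witnesses bad_witnesses_card F by (intro sets.finite_UN) auto
  have prob_A: "prob (A n) \<le> (1/4) ^ Suc n" for n
  proof -
    have "prob (A n) \<le> (\<Sum>D\<in>bad_witnesses n (0, 0). prob (F D))"
      unfolding A_def
      by (rule finite_measure_subadditive_finite) (use finite_bad_witnesses bad_witnesses_card F in auto)
    also have "\<dots> \<le> (\<Sum>D\<in>bad_witnesses n (0, 0). \<epsilon> ^ 2 ^ n)"
      using bound bad_witnesses_card unfolding F_def by (intro sum_mono) metis
    also have "\<dots> = real (card (bad_witnesses n (0, 0))) * \<epsilon> ^ 2 ^ n"
      by simp
    also have "\<dots> \<le> real (81 ^ 2 ^ n) * \<epsilon> ^ 2 ^ n"
      using card_bad_witnesses_le[of n "(0, 0)"] eps(1)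
      by (intro mult_right_mono of_nat_mono) auto
    also have "\<dots> = (81 * \<epsilon>) ^ 2 ^ n"
      by (simp add: power_mult_distrib)
    also have "\<dots> \<le> (1/4) ^ 2 ^ n"
      using eps by (intro power_mono) auto
    also have "\<dots> \<le> (1/4) ^ Suc n"
      by (intro power_decreasing) (auto simp: Suc_le_eq)
    finally show ?thesis .
  qed
  have sums: "(\<lambda>n. (1/4 :: real) ^ Suc n) sums (1/3)"
    using sums_mult[OF geometric_sums[of "1/4 :: real"], of "1/4"] by simp
  have summable: "summable (\<lambda>n. prob (A n))"
    by (rule summable_comparison_test'[OF sums_summable[OF sums], of 0]) (use prob_A in auto)
  show "(\<Union>n. A n) \<in> events"
    using A by auto
  have "prob (\<Union>n. A n) \<le> (\<Sum>n. prob (A n))"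
    using finite_measure_subadditive_countably[of A] A summable by auto
  also have "\<dots> \<le> 1/3"
    using suminf_le[OF prob_A summable sums_summable[OF sums]] sums_unique[OF sums] by simp
  finally show "prob (\<Union>n. A n) < 1" by simp
  show "\<not> bad_box (b \<omega>) n (0, 0)" if "\<omega> \<in> space M - (\<Union>n. A n)" for \<omega> n
    using that bad_box_imp_witness[of "b \<omega>" n "(0, 0)"] by (auto simp: A_def F_def)
qed

text \<open>A label is constant on the connected clusters of good sites; a good box inherits the label of
  any of its good subboxes.\<close>

primrec box_label :: "(nat \<times> nat \<Rightarrow> bool) \<Rightarrow> (nat \<times> nat \<Rightarrow> 'c) \<Rightarrow> nat \<Rightarrow> nat \<times> nat \<Rightarrow> 'c" where
  "box_label b h 0 p = h p"
| "box_label b h (Suc n) p =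
     box_label b h n (SOME u. u \<in> subboxes p \<and> \<not> bad_box b n u)"

text \<open>Connectivity is expressed by a function that agrees on neighbouring good positions, not
  by paths, so that the labels of any level can serve as \<open>f\<close>.\<close>

lemma connected_3x3:
  fixes g :: "nat \<times> nat \<Rightarrow> bool" and f :: "nat \<times> nat \<Rightarrow> 'c"
  assumes adj: "\<And>i j. g (i, j) \<Longrightarrow> g (Suc i, j) \<Longrightarrow> f (i, j) = f (Suc i, j)"
      "\<And>i j. g (i, j) \<Longrightarrow> g (i, Suc j) \<Longrightarrow> f (i, j) = f (i, Suc j)"
    and one: "\<And>u v. u \<in> subboxes p \<Longrightarrow> v \<in> subboxes p \<Longrightarrow> u \<noteq> v \<Longrightarrow> g u \<or> g v"
    and uv: "u \<in> subboxes p" "v \<in> subboxes p" "g u" "g v"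
  shows "f u = f v"
proof -
  obtain i j where p: "p = (i, j)" by (cases p)
  define G where "G s t = g (3 * i + s, 3 * j + t)" for s t
  define F where "F s t = f (3 * i + s, 3 * j + t)" for s t
  have a: "G 0 t \<Longrightarrow> G 1 t \<Longrightarrow> F 0 t = F 1 t" "G 1 t \<Longrightarrow> G 2 t \<Longrightarrow> F 1 t = F 2 t"
     "G t 0 \<Longrightarrow> G t 1 \<Longrightarrow> F t 0 = F t 1" "G t 1 \<Longrightarrow> G t 2 \<Longrightarrow> F t 1 = F t 2" for t
    using adj(1)[of "3 * i" "3 * j + t"] adj(1)[of "3 * i + 1" "3 * j + t"]
      adj(2)[of "3 * i + t" "3 * j"] adj(2)[of "3 * i + t" "3 * j + 1"]
    by (auto simp: G_def F_def numeral_2_eq_2)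
  have o: "G s t \<or> G s' t'"
    if "s \<in> {0, 1, 2}" "t \<in> {0, 1, 2}" "s' \<in> {0, 1, 2}" "t' \<in> {0, 1, 2}" "(s, t) \<noteq> (s', t')"
    for s t s' t'
    unfolding G_def by (rule one) (use that in \<open>auto simp: p subboxes_eq\<close>)
  from uv obtain s t s' t' where st: "s \<in> {0, 1, 2}" "t \<in> {0, 1, 2}" "s' \<in> {0, 1, 2}" "t' \<in> {0, 1, 2}"
      and u: "u = (3 * i + s, 3 * j + t)" and v: "v = (3 * i + s', 3 * j + t')"
    by (auto simp: p subboxes_eq)
  have "F s t = F s' t'" if "G s t" "G s' t'"
  proof -
    have "\<exists>c. \<forall>s\<in>{0,1,2}. \<forall>t\<in>{0,1,2}. G s t \<longrightarrow> F s t = c"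
    proof -
      \<comment> \<open>A good site lies in a full row or a full column, and all of these cross.\<close>
      define R where "R t \<longleftrightarrow> (\<forall>s\<in>{0, 1, 2}. G s t)" for t
      define C where "C s \<longleftrightarrow> (\<forall>t\<in>{0, 1, 2}. G s t)" for s
      have RF: "F s t = F 0 t" if "R t" "s \<in> {0, 1, 2}" for s t
        using that a(1,2)[of t] by (auto simp: R_def)
      have CF: "F s t = F s 0" if "C s" "t \<in> {0, 1, 2}" for s t
        using that a(3,4)[of s] by (auto simp: C_def)
      \<comment> \<open>The row and the column of a good position meet only there, so gaps in both
        would be two distinct bad positions.\<close>
      have full: "R t \<or> C s" if "G s t" "s \<in> {0, 1, 2}" "t \<in> {0, 1, 2}" for s t
      proof (rule ccontr)
        assume "\<not> (R t \<or> C s)"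
        then obtain s' t' where "s' \<in> {0, 1, 2}" "t' \<in> {0, 1, 2}" "\<not> G s' t" "\<not> G s t'"
          unfolding R_def C_def by blast
        moreover from this that(1) have "s' \<noteq> s" by auto
        ultimately show False using o[of s' t s t'] that by simp
      qed
      have "R 0 \<or> R 1"
      proof (rule ccontr)
        assume "\<not> (R 0 \<or> R 1)"
        then obtain s s' where "s \<in> {0, 1, 2}" "s' \<in> {0, 1, 2}" "\<not> G s 0" "\<not> G s' 1"
          unfolding R_def by blast
        then show False using o[of s 0 s' 1] by simp
      qed
      then obtain t0 where t0: "R t0" "t0 \<in> {0, 1, 2}" by blast
      have "C 0 \<or> C 1"
      proof (rule ccontr)
        assume "\<not> (C 0 \<or> C 1)"
        then obtain t t' where "t \<in> {0, 1, 2}" "t' \<in> {0, 1, 2}" "\<not> G 0 t" "\<not> G 1 t'"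
          unfolding C_def by blast
        then show False using o[of 0 t 1 t'] by simp
      qed
      then obtain s0 where s0: "C s0" "s0 \<in> {0, 1, 2}" by blast
      have "F s t = F s0 t0" if "G s t" "s \<in> {0, 1, 2}" "t \<in> {0, 1, 2}" for s t
        using full[OF that] RF CF s0 t0 that by metis
      then show ?thesis by blast
    qed
    then show ?thesis using that st by metis
  qed
  then show ?thesis
    using uv by (simp add: u v F_def G_def)
qed

text \<open>All good subboxes of a good box carry the same label, so the choice made by
  \<open>SOME\<close> is immaterial. This rests on neighbouring good boxes sharing a label, an
  invariant that passes from each level to the next.\<close>

lemma box_label_subbox:
  fixes b :: "nat \<times> nat \<Rightarrow> bool" and h :: "nat \<times> nat \<Rightarrow> 'c"
  assumes adj: "\<And>i j. \<not> b (i, j) \<Longrightarrow> \<not> b (Suc i, j) \<Longrightarrow> h (i, j) = h (Suc i, j)"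
      "\<And>i j. \<not> b (i, j) \<Longrightarrow> \<not> b (i, Suc j) \<Longrightarrow> h (i, j) = h (i, Suc j)"
  defines "g \<equiv> \<lambda>n p. \<not> bad_box b n p" and "H \<equiv> box_label b h"
  assumes "g (Suc n) p" "u \<in> subboxes p" "g n u"
  shows "H (Suc n) p = H n u"
proof -
  have one: "g n u \<or> g n v" if "g (Suc n) p" "u \<in> subboxes p" "v \<in> subboxes p" "u \<noteq> v" for n p u v
    using that by (auto simp: g_def)
  have sub: "H (Suc n) p = H n u"
    if adj': "\<And>i j. g n (i, j) \<Longrightarrow> g n (Suc i, j) \<Longrightarrow> H n (i, j) = H n (Suc i, j)"
      "\<And>i j. g n (i, j) \<Longrightarrow> g n (i, Suc j) \<Longrightarrow> H n (i, j) = H n (i, Suc j)"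
      and p: "g (Suc n) p" and u: "u \<in> subboxes p" "g n u" for n p u
  proof -
    let ?v = "SOME u. u \<in> subboxes p \<and> \<not> bad_box b n u"
    have "?v \<in> subboxes p \<and> \<not> bad_box b n ?v"
      by (rule someI[of _ u]) (use u g_def in auto)
    then have "H n ?v = H n u"
      using connected_3x3[of "g n" "H n" p ?v u] adj' one[OF p] u g_def by blast
    then show ?thesis by (simp add: H_def)
  qed
  have main: "(\<forall>i j. g n (i, j) \<longrightarrow> g n (Suc i, j) \<longrightarrow> H n (i, j) = H n (Suc i, j)) \<and>
      (\<forall>i j. g n (i, j) \<longrightarrow> g n (i, Suc j) \<longrightarrow> H n (i, j) = H n (i, Suc j))" for n
  proof (induction n)
    case 0
    then show ?case using adj by (auto simp: g_def H_def)
  next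
    case (Suc n)
    have s: "H (Suc n) p = H n u" if "g (Suc n) p" "u \<in> subboxes p" "g n u" for p u
      by (rule sub) (use Suc that in auto)
    have "H (Suc n) (i, j) = H (Suc n) (Suc i, j)" if that': "g (Suc n) (i, j)" "g (Suc n) (Suc i, j)" for i j
    proof -
      \<comment> \<open>\<open>?u t\<close> runs along the side of the first box that faces the
        second, and \<open>?v t\<close> along the opposite side, which starts at
        \<open>3 * (i + 1)\<close>.\<close>
      let ?u = "\<lambda>t. (3 * i + 2, 3 * j + t)" and ?v = "\<lambda>t. (3 * i + 3, 3 * j + t)"
      have mem: "t \<in> {0,1,2} \<Longrightarrow> ?u t \<in> subboxes (i, j) \<and> ?v t \<in> subboxes (Suc i, j)" for t
        by (auto simp: subboxes_def)
      have "g n (?u s) \<or> g n (?u t)" "g n (?v s) \<or> g n (?v t)"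
        if "s \<in> {0,1,2}" "t \<in> {0,1,2}" "s \<noteq> t" for s t
        using one[OF that'(1), of "?u s" "?u t"] one[OF that'(2), of "?v s" "?v t"] mem that by auto
      \<comment> \<open>Of the three facing pairs, each box spoils at most one, so some pair is good
        on both sides.\<close>
      from this[of 0 1] this[of 0 2] this[of 1 2] have "\<exists>t\<in>{0,1,2}. g n (?u t) \<and> g n (?v t)"
        by auto
      then obtain t where t: "t \<in> {0,1,2}" "g n (?u t)" "g n (?v t)" by blast
      have "H n (?u t) = H n (?v t)"
        using Suc t by (auto simp: numeral_2_eq_2 numeral_3_eq_3)
      then show ?thesis
        using s[OF that'(1)] s[OF that'(2)] mem t by metis
    qed
    moreover have "H (Suc n) (i, j) = H (Suc n) (i, Suc j)"
      if that': "g (Suc n) (i, j)" "g (Suc n) (i, Suc j)" for i j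
    proof -
      let ?u = "\<lambda>t. (3 * i + t, 3 * j + 2)" and ?v = "\<lambda>t. (3 * i + t, 3 * j + 3)"
      have mem: "t \<in> {0,1,2} \<Longrightarrow> ?u t \<in> subboxes (i, j) \<and> ?v t \<in> subboxes (i, Suc j)" for t
        by (auto simp: subboxes_def)
      have "g n (?u s) \<or> g n (?u t)" "g n (?v s) \<or> g n (?v t)"
        if "s \<in> {0,1,2}" "t \<in> {0,1,2}" "s \<noteq> t" for s t
        using one[OF that'(1), of "?u s" "?u t"] one[OF that'(2), of "?v s" "?v t"] mem that by auto
      from this[of 0 1] this[of 0 2] this[of 1 2] have "\<exists>t\<in>{0,1,2}. g n (?u t) \<and> g n (?v t)"
        by auto
      then obtain t where t: "t \<in> {0,1,2}" "g n (?u t)" "g n (?v t)" by blast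
      have "H n (?u t) = H n (?v t)"
        using Suc t by (auto simp: numeral_2_eq_2 numeral_3_eq_3)
      then show ?thesis
        using s[OF that'(1)] s[OF that'(2)] mem t by metis
    qed
    ultimately show ?case by blast
  qed
  show ?thesis
    by (rule sub) (use main assms(5-) in auto)
qed

text \<open>Two distinct subboxes of a good box cannot both be bad, so a descent through good
  subboxes is possible; it preserves the label and ends at a good site inside the box.\<close>

lemma good_box_contains_good_site:
  assumes "\<And>i j. \<not> b (i, j) \<Longrightarrow> \<not> b (Suc i, j) \<Longrightarrow> h (i, j) = h (Suc i, j)"
      "\<And>i j. \<not> b (i, j) \<Longrightarrow> \<not> b (i, Suc j) \<Longrightarrow> h (i, j) = h (i, Suc j)"
    and "\<not> bad_box b n p"
  shows "\<exists>q. \<not> b q \<and> h q = box_label b h n p \<and> fst q div 3 ^ n = fst p \<and> snd q div 3 ^ n = snd p"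
  using assms(3)
proof (induction n arbitrary: p)
  case (Suc n)
  have "(3 * fst p, 3 * snd p) \<in> subboxes p" "(3 * fst p + 1, 3 * snd p) \<in> subboxes p"
    by (auto simp: subboxes_def)
  moreover have "(3 * fst p, 3 * snd p) \<noteq> (3 * fst p + 1, 3 * snd p)"
    by simp
  ultimately obtain u where u: "u \<in> subboxes p" "\<not> bad_box b n u"
    using Suc.prems unfolding bad_box.simps by metis
  have "box_label b h (Suc n) p = box_label b h n u"
    by (rule box_label_subbox[where b = b and h = h, OF assms(1,2) Suc.prems u])
  moreover obtain q where "\<not> b q" "h q = box_label b h n u" "fst q div 3 ^ n = fst u" "snd q div 3 ^ n = snd u"
    using Suc.IH[OF u(2)] by blast
  ultimately show ?case
    using u(1)
    by (intro exI[of _ q]) (simp add: subboxes_def power_Suc2 div_mult2_eq del: power_Suc box_label.simps)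
next
  case 0
  then show ?case by (intro exI[of _ p]) simp
qed

text \<open>The boxes at the origin are nested and all good, so each carries the label of
  \<open>(0, 0)\<close>.\<close>

lemma infinite_good_cluster:
  fixes b :: "nat \<times> nat \<Rightarrow> bool" and h :: "nat \<times> nat \<Rightarrow> 'c"
  assumes adj: "\<And>i j. \<not> b (i, j) \<Longrightarrow> \<not> b (Suc i, j) \<Longrightarrow> h (i, j) = h (Suc i, j)"
      "\<And>i j. \<not> b (i, j) \<Longrightarrow> \<not> b (i, Suc j) \<Longrightarrow> h (i, j) = h (i, Suc j)"
    and good: "\<And>n. \<not> bad_box b n (0, 0)"
  shows "infinite {q. \<not> b q \<and> h q = h (0, 0)}"
proof
  let ?C = "{q. \<not> b q \<and> h q = h (0, 0)}"
  assume fin: "finite ?C"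
  have sub: "box_label b h (Suc n) (0, 0) = box_label b h n u"
    if "u \<in> subboxes (0, 0)" "\<not> bad_box b n u" for n u
    by (rule box_label_subbox[where b = b and h = h, OF adj good that])
  have H: "box_label b h n (0, 0) = h (0, 0)" for n
  proof (induction n)
    case (Suc n)
    then show ?case using sub[of "(0, 0)" n] good by (simp add: subboxes_def)
  qed simp
  have far: "\<exists>q\<in>?C. 3 ^ n \<le> fst q + snd q" for n
  proof -
    \<comment> \<open>One of these two subboxes is good, and the good site found in it lies outside
      the box of level \<open>n\<close> at the origin.\<close>
    have mem: "(1, 0) \<in> subboxes (0, 0)" "(0, 1) \<in> subboxes (0, 0)"
      by (auto simp: subboxes_def)
    then obtain u where u: "u \<in> subboxes (0, 0)" "\<not> bad_box b n u" "u = (1, 0) \<or> u = (0, 1)"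
      using good[of "Suc n"] unfolding bad_box.simps by (metis prod.inject zero_neq_one)
    obtain q where q: "\<not> b q" "h q = box_label b h n u"
        "fst q div 3 ^ n = fst u" "snd q div 3 ^ n = snd u"
      using good_box_contains_good_site[of b h n u] adj u(2) by metis
    have "q \<in> ?C"
      using q(1,2) sub[OF u(1,2)] H[of "Suc n"] by simp
    moreover have "3 ^ n \<le> fst q + snd q"
    proof (rule ccontr)
      assume "\<not> 3 ^ n \<le> fst q + snd q"
      then have "fst q div 3 ^ n = 0" "snd q div 3 ^ n = 0"
        by auto
      with q(3,4) u(3) show False by auto
    qed
    ultimately show ?thesis by blast
  qed
  \<comment> \<open>For a finite cluster \<open>m\<close> bounds every coordinate sum, whereas
    \<open>far\<close> gives a site with sum at least \<open>3 ^ m\<close>.\<close>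
  define m where "m = (\<Sum>q\<in>?C. fst q + snd q)"
  obtain q where "q \<in> ?C" "3 ^ m \<le> fst q + snd q"
    using far by blast
  moreover from this(1) have "fst q + snd q \<le> m"
    unfolding m_def using fin member_le_sum[of q ?C "\<lambda>q. fst q + snd q"] by simp
  moreover have "m < 3 ^ m"
    by (rule less_exp[THEN order.strict_trans2]) (simp add: power_mono)
  ultimately show False by linarith
qed

subsection \<open>Measurability of the percolation event\<close>

text \<open>Boundedness matters because the counts are controlled on bounded sets only.\<close>

lemma bounded_open_base_sequence:
  obtains S :: "nat \<Rightarrow> 'a::euclidean_space set"
  where "\<And>i. open (S i)" "\<And>i. bounded (S i)"
    "\<And>x T. open T \<Longrightarrow> x \<in> T \<Longrightarrow> \<exists>i. x \<in> S i \<and> S i \<subseteq> T"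
proof -
  obtain B :: "'a set set" where B: "countable B" "topological_basis B"
    using ex_countable_basis by blast
  \<comment> \<open>Adjoining the empty set ensures nonemptiness, so that
    \<open>from_nat_into\<close> enumerates exactly \<open>B'\<close>.\<close>
  define B' where "B' = insert {} {b \<in> B. bounded b}"
  have count: "countable B'" and ne: "B' \<noteq> {}"
    using B(1) by (auto simp: B'_def)
  have range: "range (from_nat_into B') = B'"
    by (rule range_from_nat_into[OF ne count])
  show ?thesis
  proof
    show "open (from_nat_into B' i)" "bounded (from_nat_into B' i)" for i
      using from_nat_into[OF ne, of i] topological_basis_open[OF B(2)] by (auto simp: B'_def)
    show "\<exists>i. x \<in> from_nat_into B' i \<and> from_nat_into B' i \<subseteq> T" if T: "open T" "x \<in> T" for x T
    proof -
      obtain b where b: "b \<in> B" "x \<in> b" "b \<subseteq> T \<inter> ball x 1"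
        using topological_basisE[OF B(2), of "T \<inter> ball x 1" x] T by auto
      then have "b \<in> B'"
        using bounded_subset[OF bounded_ball, of b x 1] by (auto simp: B'_def)
      then obtain i where "from_nat_into B' i = b"
        using range by (metis imageE)
      with b show ?thesis by blast
    qed
  qed
qed

text \<open>Every point of a locally finite set is the sole point in some member of a countable base, which
  gives a countable measurable enumeration of the process.\<close>

definition sole_point :: "'a::zero set \<Rightarrow> 'a set \<Rightarrow> 'a" where
  "sole_point V B = (if card (V \<inter> B) = 1 then the_elem (V \<inter> B) else 0)"

lemma sole_point_eq: "V \<inter> B = {x} \<Longrightarrow> sole_point V B = x"
  by (simp add: sole_point_def)

lemma sole_point_mem: "card (V \<inter> B) = 1 \<Longrightarrow> sole_point V B \<in> V \<inter> B"
  by (metis card_1_singletonE insertI1 sole_point_eq)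

text \<open>If \<open>B\<close> contains exactly one point, that point lies in \<open>A\<close> iff
  the count in \<open>B \<inter> A\<close> is 1; otherwise the value is 0. Preimages are thus
  decided by counts.\<close>

lemma (in homogeneous_poisson_process) borel_measurable_sole_point:
  assumes B: "B \<in> sets borel" "bounded B"
  shows "(\<lambda>\<omega>. sole_point (X \<omega>) B) \<in> borel_measurable M"
proof (rule measurableI)
  fix A :: "'a set"
  assume A: "A \<in> sets borel"
  have [measurable]: "(\<lambda>\<omega>. card (X \<omega> \<inter> B)) \<in> measurable M (count_space UNIV)"
    "(\<lambda>\<omega>. card (X \<omega> \<inter> (B \<inter> A))) \<in> measurable M (count_space UNIV)"
    using B A by (auto intro!: count_measurable bounded_subset[OF B(2)])
  have mem: "sole_point (X \<omega>) B \<in> A \<longleftrightarrow> card (X \<omega> \<inter> (B \<inter> A)) = 1" if one: "card (X \<omega> \<inter> B) = 1" for \<omega>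
  proof -
    obtain x where x: "X \<omega> \<inter> B = {x}"
      using card_1_singletonE[OF one] by blast
    then have "X \<omega> \<inter> (B \<inter> A) = {x} \<inter> A" by blast
    then show ?thesis by (simp add: sole_point_eq[OF x] Int_insert_left)
  qed
  have "(\<lambda>\<omega>. sole_point (X \<omega>) B) -` A \<inter> space M =
      {\<omega> \<in> space M. if card (X \<omega> \<inter> B) = 1 then card (X \<omega> \<inter> (B \<inter> A)) = 1 else 0 \<in> A}"
    using mem by (auto simp: sole_point_def)
  also have "\<dots> \<in> events"
    by measurable
  finally show "(\<lambda>\<omega>. sole_point (X \<omega>) B) -` A \<inter> space M \<in> events" .
qed simp

section \<open>Edges and components through countable conditions\<close>

lemma le_infdist_iff:
  assumes "A \<noteq> {}"
  shows "t \<le> infdist x A \<longleftrightarrow> (\<forall>z\<in>A. t \<le> dist x z)"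
proof
  assume "t \<le> infdist x A"
  then show "\<forall>z\<in>A. t \<le> dist x z"
    using infdist_le order.trans by metis
next
  assume "\<forall>z\<in>A. t \<le> dist x z"
  then show "t \<le> infdist x A"
    using assms by (simp add: infdist_notempty cINF_greatest)
qed

text \<open>Quantifying over points instead of taking an infimum leaves only distances, which are
  measurable along an enumeration of the points.\<close>

lemma gn1_edges_iff:
  assumes "0 < \<alpha>"
  shows "(x, y) \<in> gn1_edges \<alpha> V \<longleftrightarrow> x \<in> V \<and> y \<in> V \<and> x \<noteq> y \<and>
    ((\<forall>z\<in>V. z \<noteq> x \<longrightarrow> dist x y \<le> \<alpha> * dist x z) \<or> (\<forall>z\<in>V. z \<noteq> y \<longrightarrow> dist x y \<le> \<alpha> * dist y z))"
proof -
  \<comment> \<open>The point \<open>v\<close> makes the set of other points nonempty;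
    \<open>infdist\<close> to the empty set would be 0.\<close>
  have *: "dist x y \<le> \<alpha> * nn_dist V u \<longleftrightarrow> (\<forall>z\<in>V. z \<noteq> u \<longrightarrow> dist x y \<le> \<alpha> * dist u z)"
    if "v \<in> V" "v \<noteq> u" for u v
    using le_infdist_iff[of "V - {u}" "dist x y / \<alpha>" u] that assms
    by (auto simp: nn_dist_def field_simps)
  show ?thesis
    unfolding gn1_edges_def using *[of x y] *[of y x] by auto
qed

lemma sym_gn1_edges: "sym (gn1_edges \<alpha> V)"
  by (auto simp: sym_def gn1_edges_def dist_commute)

lemma component_subset: "x \<in> V \<Longrightarrow> component (gn1_edges \<alpha> V) x \<subseteq> V"
  unfolding component_def
  by (auto elim: rtranclE simp: gn1_edges_def)

text \<open>Allows infinite components to be recognised by points of arbitrarily large norm.\<close>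

lemma finite_iff_bounded_if_locally_finite:
  assumes "\<And>B. bounded B \<Longrightarrow> finite (V \<inter> B)" "C \<subseteq> V"
  shows "finite C \<longleftrightarrow> bounded C"
  using assms by (metis finite_imp_bounded inf.absorb_iff2)

lemma bounded_iff_nat: "bounded C \<longleftrightarrow> (\<exists>m::nat. \<forall>z\<in>C. norm z \<le> real m)"
proof
  assume "bounded C"
  then obtain r where "\<forall>z\<in>C. norm z \<le> r"
    unfolding bounded_iff by blast
  moreover obtain m :: nat where "r \<le> real m"
    using real_arch_simple by blast
  ultimately show "\<exists>m::nat. \<forall>z\<in>C. norm z \<le> real m"
    using order.trans by blast
qed (auto simp: bounded_iff)

lemma (in homogeneous_poisson_process) gn1_percolation_event_in_events:
  assumes "0 < \<alpha>"
  shows "gn1_percolation_event M X \<alpha> \<in> events"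
proof -
  obtain S :: "nat \<Rightarrow> 'a set" where S: "\<And>i. open (S i)" "\<And>i. bounded (S i)"
      and base: "\<And>x T. open T \<Longrightarrow> x \<in> T \<Longrightarrow> \<exists>i. x \<in> S i \<and> S i \<subseteq> T"
    using bounded_open_base_sequence[where 'a = 'a] by blast
  define ok where "ok i \<omega> \<longleftrightarrow> card (X \<omega> \<inter> S i) = 1" for i \<omega>
  define \<xi> where "\<xi> i \<omega> = sole_point (X \<omega>) (S i)" for i \<omega>
  have \<xi>_mem: "\<xi> i \<omega> \<in> X \<omega>" if "ok i \<omega>" for i \<omega>
    using that sole_point_mem by (auto simp: ok_def \<xi>_def)
  have \<xi>_surj: "\<exists>i. ok i \<omega> \<and> \<xi> i \<omega> = x" if "\<omega> \<in> space M" "x \<in> X \<omega>" for \<omega> x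
  proof -
    have fin: "finite (X \<omega> \<inter> ball x 1 - {x})"
      using locally_finite[OF that(1) bounded_ball] by blast
    \<comment> \<open>Removing the finitely many other points near \<open>x\<close> leaves an open
      neighbourhood, inside which a base set isolates \<open>x\<close>.\<close>
    have "open (ball x 1 - (X \<omega> \<inter> ball x 1 - {x}))"
      by (rule open_Diff[OF open_ball finite_imp_closed[OF fin]])
    from base[OF this, of x] obtain i where i: "x \<in> S i" "S i \<subseteq> ball x 1 - (X \<omega> \<inter> ball x 1 - {x})"
      by auto
    then have "X \<omega> \<inter> S i = {x}"
      using that by blast
    then show ?thesis
      using sole_point_eq by (intro exI[of _ i]) (auto simp: ok_def \<xi>_def)
  qed
  have ball_iff: "(\<forall>z\<in>X \<omega>. P z) \<longleftrightarrow> (\<forall>i. ok i \<omega> \<longrightarrow> P (\<xi> i \<omega>))" if "\<omega> \<in> space M" for P \<omega>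
    using \<xi>_mem \<xi>_surj[OF that] by metis
  have bex_iff: "(\<exists>z\<in>X \<omega>. P z) \<longleftrightarrow> (\<exists>i. ok i \<omega> \<and> P (\<xi> i \<omega>))" if "\<omega> \<in> space M" for P \<omega>
    using \<xi>_mem \<xi>_surj[OF that] by metis
  \<comment> \<open>Several indices may name the same point, so points are compared rather than
    indices.\<close>
  define far where "far i j k \<omega> \<longleftrightarrow> (\<forall>l. ok l \<omega> \<longrightarrow> \<xi> l \<omega> \<noteq> \<xi> k \<omega> \<longrightarrow>
    dist (\<xi> i \<omega>) (\<xi> j \<omega>) \<le> \<alpha> * dist (\<xi> k \<omega>) (\<xi> l \<omega>))" for i j k \<omega>
  define edge where "edge i j \<omega> \<longleftrightarrow> ok i \<omega> \<and> ok j \<omega> \<and> \<xi> i \<omega> \<noteq> \<xi> j \<omega> \<and> (far i j i \<omega> \<or> far i j j \<omega>)" for i j \<omega>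
  define reach where "reach n i j \<omega> \<longleftrightarrow> (\<xi> i \<omega>, \<xi> j \<omega>) \<in> gn1_edges \<alpha> (X \<omega>) ^^ n" for n i j \<omega>
  have edge_iff: "(\<xi> i \<omega>, \<xi> j \<omega>) \<in> gn1_edges \<alpha> (X \<omega>) \<longleftrightarrow> edge i j \<omega>"
    if "\<omega> \<in> space M" "ok i \<omega>" "ok j \<omega>" for i j \<omega>
    unfolding gn1_edges_iff[OF assms] ball_iff[OF that(1)] edge_def far_def
    using that \<xi>_mem by blast
  have meas_ok[measurable]: "Measurable.pred M (ok i)" for i
  proof -
    have [measurable]: "(\<lambda>\<omega>. card (X \<omega> \<inter> S i)) \<in> measurable M (count_space UNIV)"
      using S by (intro count_measurable) auto
    show ?thesis unfolding ok_def[abs_def] by measurable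
  qed
  have meas_\<xi>[measurable]: "\<xi> i \<in> borel_measurable M" for i
    unfolding \<xi>_def[abs_def] using S by (intro borel_measurable_sole_point) auto
  have meas_far[measurable]: "Measurable.pred M (far i j k)" for i j k
    unfolding far_def[abs_def] by measurable
  have meas_edge[measurable]: "Measurable.pred M (edge i j)" for i j
    unfolding edge_def[abs_def] by measurable
  have reach_Suc: "reach (Suc n) i j \<omega> \<longleftrightarrow> (\<exists>k. ok k \<omega> \<and> reach n i k \<omega> \<and> edge k j \<omega>)"
    if j: "\<omega> \<in> space M" "ok j \<omega>" for n i j \<omega>
  proof
    assume "reach (Suc n) i j \<omega>"
    then obtain z where z: "(\<xi> i \<omega>, z) \<in> gn1_edges \<alpha> (X \<omega>) ^^ n" "(z, \<xi> j \<omega>) \<in> gn1_edges \<alpha> (X \<omega>)"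
      by (auto simp: reach_def)
    then have "z \<in> X \<omega>" by (auto simp: gn1_edges_def)
    then obtain k where "ok k \<omega>" "\<xi> k \<omega> = z"
      using \<xi>_surj[OF j(1)] by blast
    with z edge_iff j show "\<exists>k. ok k \<omega> \<and> reach n i k \<omega> \<and> edge k j \<omega>"
      by (auto simp: reach_def)
  next
    assume "\<exists>k. ok k \<omega> \<and> reach n i k \<omega> \<and> edge k j \<omega>"
    then show "reach (Suc n) i j \<omega>"
      using edge_iff j by (auto simp: reach_def)
  qed
  \<comment> \<open>\<open>ok j\<close> is carried along because \<open>reach_Suc\<close> holds for
    genuine points; without it \<open>\<xi> j\<close> is the default 0.\<close>
  have meas_reach: "Measurable.pred M (\<lambda>\<omega>. ok j \<omega> \<and> reach n i j \<omega>)" for n i j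
  proof (induction n arbitrary: j)
    case 0
    have "Measurable.pred M (\<lambda>\<omega>. ok j \<omega> \<and> \<xi> i \<omega> = \<xi> j \<omega>)"
      by measurable
    then show ?case by (simp add: reach_def)
  next
    case (Suc n)
    have [measurable]: "Measurable.pred M (\<lambda>\<omega>. ok k \<omega> \<and> reach n i k \<omega>)" for k
      by (rule Suc)
    have "Measurable.pred M (\<lambda>\<omega>. ok j \<omega> \<and> (\<exists>k. (ok k \<omega> \<and> reach n i k \<omega>) \<and> edge k j \<omega>))"
      by measurable
    then show ?case
      by (rule measurable_cong[THEN iffD1, rotated]) (use reach_Suc in auto)
  qed
  have event: "has_infinite_component (X \<omega>) (gn1_edges \<alpha> (X \<omega>)) \<longleftrightarrow>
      (\<exists>i. ok i \<omega> \<and> (\<forall>m. \<exists>j n. (ok j \<omega> \<and> reach n i j \<omega>) \<and> real m < norm (\<xi> j \<omega>)))"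
    if \<omega>: "\<omega> \<in> space M" for \<omega>
  proof -
    have "infinite (component (gn1_edges \<alpha> (X \<omega>)) (\<xi> i \<omega>)) \<longleftrightarrow>
        (\<forall>m. \<exists>j n. (ok j \<omega> \<and> reach n i j \<omega>) \<and> real m < norm (\<xi> j \<omega>))" if "ok i \<omega>" for i
    proof -
      let ?C = "component (gn1_edges \<alpha> (X \<omega>)) (\<xi> i \<omega>)"
      have sub: "?C \<subseteq> X \<omega>"
        using component_subset \<xi>_mem that by blast
      have "finite ?C \<longleftrightarrow> bounded ?C"
        using finite_iff_bounded_if_locally_finite[of "X \<omega>" ?C] locally_finite[OF \<omega>] sub by blast
      also have "\<dots> \<longleftrightarrow> (\<exists>m::nat. \<forall>z\<in>?C. norm z \<le> real m)"
        by (rule bounded_iff_nat)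
      finally have fin_iff: "finite ?C \<longleftrightarrow> (\<exists>m::nat. \<forall>z\<in>?C. norm z \<le> real m)" .
      have "infinite ?C \<longleftrightarrow> (\<forall>m::nat. \<exists>z\<in>X \<omega>. z \<in> ?C \<and> real m < norm z)"
        using sub unfolding fin_iff by (meson in_mono not_le)
      also have "\<dots> \<longleftrightarrow> (\<forall>m::nat. \<exists>j. ok j \<omega> \<and> \<xi> j \<omega> \<in> ?C \<and> real m < norm (\<xi> j \<omega>))"
        unfolding bex_iff[OF \<omega>] by simp
      also have "\<dots> \<longleftrightarrow> (\<forall>m. \<exists>j n. (ok j \<omega> \<and> reach n i j \<omega>) \<and> real m < norm (\<xi> j \<omega>))"
        by (auto simp: component_def rtrancl_power reach_def)
      finally show ?thesis .
    qed
    then show ?thesis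
      unfolding has_infinite_component_def bex_iff[OF \<omega>] by blast
  qed
  note meas_reach[measurable]
  have "Measurable.pred M
      (\<lambda>\<omega>. \<exists>i. ok i \<omega> \<and> (\<forall>m. \<exists>j n. (ok j \<omega> \<and> reach n i j \<omega>) \<and> real m < norm (\<xi> j \<omega>)))"
    by measurable
  then have "{\<omega> \<in> space M. \<exists>i. ok i \<omega> \<and>
      (\<forall>m. \<exists>j n. (ok j \<omega> \<and> reach n i j \<omega>) \<and> real m < norm (\<xi> j \<omega>))} \<in> events"
    by measurable
  also have "{\<omega> \<in> space M. \<exists>i. ok i \<omega> \<and>
      (\<forall>m. \<exists>j n. (ok j \<omega> \<and> reach n i j \<omega>) \<and> real m < norm (\<xi> j \<omega>))} = gn1_percolation_event M X \<alpha>"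
    unfolding gn1_percolation_event_def using event by blast
  finally show ?thesis .
qed

subsection \<open>Isolated points in cells\<close>

text \<open>Cells are cubes of side 3 in a two-dimensional layer spanned by the axes \<open>a\<close> and \<open>b\<close>. A point that is
  alone in its cell and lies in the core of side 1 is at distance at least 1 from all other points,
  an event that depends on the process inside the cell only.\<close>

definition cell_corner :: "'n \<Rightarrow> 'n \<Rightarrow> nat \<times> nat \<Rightarrow> real ^ 'n" where
  "cell_corner a b c =
     (\<chi> k. if k = a then 3 * real (fst c) else if k = b then 3 * real (snd c) else 0)"

definition cell :: "'n \<Rightarrow> 'n \<Rightarrow> nat \<times> nat \<Rightarrow> (real ^ 'n) set" where
  "cell a b c = box (cell_corner a b c) (cell_corner a b c + (\<chi> k. 3))"

definition core :: "'n \<Rightarrow> 'n \<Rightarrow> nat \<times> nat \<Rightarrow> (real ^ 'n) set" where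
  "core a b c = cbox (cell_corner a b c + (\<chi> k. 1)) (cell_corner a b c + (\<chi> k. 2))"

text \<open>Two counts on disjoint bounded sets, so that the law and the independence of the Poisson
  counts apply directly.\<close>

definition isolated_in_cell :: "'n \<Rightarrow> 'n \<Rightarrow> (real ^ 'n) set \<Rightarrow> nat \<times> nat \<Rightarrow> bool" where
  "isolated_in_cell a b V c \<longleftrightarrow>
     card (V \<inter> core a b c) = 1 \<and> card (V \<inter> (cell a b c - core a b c)) = 0"

section \<open>Geometry of cells\<close>

lemma mem_cell: "x \<in> cell a b c \<longleftrightarrow> (\<forall>k. cell_corner a b c $ k < x $ k \<and> x $ k < cell_corner a b c $ k + 3)"
  by (simp add: cell_def mem_box_cart)

lemma mem_core: "x \<in> core a b c \<longleftrightarrow> (\<forall>k. cell_corner a b c $ k + 1 \<le> x $ k \<and> x $ k \<le> cell_corner a b c $ k + 2)"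
  by (simp add: core_def mem_box_cart)

lemma core_subset_cell: "core a b c \<subseteq> cell a b c"
  unfolding subset_iff mem_cell mem_core by (smt (verit))

lemma bounded_cell: "bounded (cell a b c)"
  by (simp add: cell_def)

lemma cells_disjoint:
  assumes "a \<noteq> b" "c \<noteq> c'"
  shows "cell a b c \<inter> cell a b c' = {}"
proof (rule ccontr)
  assume "cell a b c \<inter> cell a b c' \<noteq> {}"
  then obtain x where x: "x \<in> cell a b c" "x \<in> cell a b c'" by blast
  have "fst c = fst c'"
    using x[unfolded mem_cell, THEN spec[of _ a]] by (auto simp: cell_corner_def)
  moreover have "snd c = snd c'"
    using x[unfolded mem_cell, THEN spec[of _ b]] assms(1) by (auto simp: cell_corner_def)
  ultimately show False
    using assms(2) by (simp add: prod_eq_iff)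
qed

lemma measure_core: "measure lborel (core a b c) = 1"
proof -
  have "core a b c \<noteq> {}"
    unfolding core_def by (simp add: interval_ne_empty_cart)
  then show ?thesis
    unfolding core_def by (subst content_cbox_cart) simp_all
qed

lemma measure_cell: "measure lborel (cell a b c :: (real ^ 'n) set) = 3 ^ CARD('n)"
proof -
  have "cbox (cell_corner a b c) (cell_corner a b c + (\<chi> k. 3)) \<noteq> {}"
    by (simp add: interval_ne_empty_cart)
  then have "measure lborel (cbox (cell_corner a b c) (cell_corner a b c + (\<chi> k. 3))) = 3 ^ CARD('n)"
    by (subst content_cbox_cart) simp_all
  then show ?thesis
    by (simp add: cell_def measure_lborel_box_eq measure_lborel_cbox_eq)
qed

lemma measure_shell:
  "measure lborel (cell a b c - core a b c :: (real ^ 'n) set) = 3 ^ CARD('n) - 1"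
proof -
  have "measure lborel (cell a b c - core a b c) = measure lborel (cell a b c) - measure lborel (core a b c)"
    by (rule measure_Diff) (use core_subset_cell[of a b c] in \<open>auto simp: cell_def core_def emeasure_lborel_box_eq\<close>)
  then show ?thesis by (simp add: measure_core measure_cell)
qed

text \<open>The Euclidean norm is at most the sum of the absolute coordinates. In each, corners
  differ by at most \<open>3 * D\<close> and positions within cells by at most 3.\<close>

lemma dist_cells_le:
  fixes x y :: "real ^ 'n" and D :: real
  assumes x: "x \<in> cell a b c" and y: "y \<in> cell a b c'"
    and D: "\<bar>real (fst c) - real (fst c')\<bar> \<le> D" "\<bar>real (snd c) - real (snd c')\<bar> \<le> D"
  shows "dist x y \<le> CARD('n) * (3 * D + 3)"
proof -
  have "\<bar>(x - y) $ k\<bar> \<le> 3 * D + 3" for k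
    using x[unfolded mem_cell, THEN spec[of _ k]] y[unfolded mem_cell, THEN spec[of _ k]] D
    by (auto simp: cell_corner_def split: if_splits)
  then have "(\<Sum>k\<in>UNIV. \<bar>(x - y) $ k\<bar>) \<le> CARD('n) * (3 * D + 3)"
    by (rule order.trans[OF sum_bounded_above]) auto
  then show ?thesis
    using norm_le_l1_cart[of "x - y"] by (simp add: dist_norm)
qed

text \<open>Any other point lies outside the cell, hence beyond a face in some coordinate, and every
  face is at distance 1 from the core.\<close>

lemma isolated_in_cellE:
  assumes "isolated_in_cell a b V c" "finite (V \<inter> cell a b c)"
  obtains x where "x \<in> V" "x \<in> cell a b c" "\<And>y. y \<in> V \<Longrightarrow> y \<noteq> x \<Longrightarrow> 1 \<le> dist x y"
proof -
  from assms(1) obtain x where x: "V \<inter> core a b c = {x}"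
    unfolding isolated_in_cell_def using card_1_singletonE by metis
  \<comment> \<open>\<open>card\<close> is also 0 on infinite sets, so emptiness needs
    finiteness.\<close>
  have shell: "V \<inter> (cell a b c - core a b c) = {}"
  proof -
    have "finite (V \<inter> (cell a b c - core a b c))"
      by (rule finite_subset[OF _ assms(2)]) auto
    then show ?thesis
      using assms(1) by (simp add: isolated_in_cell_def)
  qed
  have "1 \<le> dist x y" if "y \<in> V" "y \<noteq> x" for y
  proof -
    have "y \<notin> cell a b c"
      using that x shell by blast
    then obtain k where k: "y $ k \<le> cell_corner a b c $ k \<or> cell_corner a b c $ k + 3 \<le> y $ k"
      unfolding mem_cell by (meson not_less)
    have "x \<in> core a b c" using x by blast
    then have "1 \<le> \<bar>(x - y) $ k\<bar>"
      using k unfolding mem_core by (smt (verit) vector_minus_component)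
    also have "\<dots> \<le> dist x y"
      unfolding dist_norm by (rule component_le_norm_cart)
    finally show ?thesis .
  qed
  then show ?thesis
    using that x core_subset_cell by blast
qed

section \<open>Law and independence of isolated points\<close>

locale planar_poisson_cells =
  homogeneous_poisson_process M density X
  for M :: "'w measure" and density :: real and X :: "'w \<Rightarrow> (real ^ 'n) set" +
  fixes a b :: 'n
  assumes axes_distinct: "a \<noteq> b"
begin

text \<open>One point in the core, of volume 1, and none in the rest of the cell, of volume
  \<open>3 ^ CARD('n) - 1\<close>.\<close>

definition isolation_prob :: real where
  "isolation_prob = density * exp (- density) * exp (- (density * (3 ^ CARD('n) - 1)))"

lemma isolation_prob_pos: "0 < isolation_prob"
  using density_pos by (simp add: isolation_prob_def)

lemma borel_cell_sets:
  "core a b c \<in> sets borel" "bounded (core a b c)"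
  "cell a b c - core a b c \<in> sets borel" "bounded (cell a b c - core a b c)"
proof -
  show "bounded (core a b c)" "bounded (cell a b c - core a b c)"
    using bounded_subset[OF bounded_cell] core_subset_cell by blast+
qed (auto simp: cell_def core_def)

lemma measurable_isolated[measurable]: "Measurable.pred M (\<lambda>\<omega>. isolated_in_cell a b (X \<omega>) c)"
proof -
  note [measurable] = count_measurable[OF borel_cell_sets(1,2)] count_measurable[OF borel_cell_sets(3,4)]
  show ?thesis
    unfolding isolated_in_cell_def by measurable
qed

lemma prob_isolated: "prob {\<omega> \<in> space M. isolated_in_cell a b (X \<omega>) c} = isolation_prob"
proof -
  define B where "B i = (if i = 0 then core a b c else cell a b c - core a b c)" for i :: nat
  define A where "A i = (if i = 0 then {1} else {0 :: nat})" for i :: nat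
  have two: "{..<2} = {0, 1 :: nat}" by auto
  have "indep_vars (\<lambda>_. count_space UNIV) (\<lambda>i \<omega>. card (X \<omega> \<inter> B i)) {..<2::nat}"
    by (rule count_indep) (use borel_cell_sets in \<open>auto simp: B_def disjoint_family_on_def\<close>)
  then have "prob (\<Inter>i\<in>{..<2}. (\<lambda>\<omega>. card (X \<omega> \<inter> B i)) -` A i \<inter> space M) =
      (\<Prod>i\<in>{..<2}. prob ((\<lambda>\<omega>. card (X \<omega> \<inter> B i)) -` A i \<inter> space M))"
    by (rule indep_varsD) (auto simp: two)
  moreover have "(\<Inter>i\<in>{..<2}. (\<lambda>\<omega>. card (X \<omega> \<inter> B i)) -` A i \<inter> space M) =
      {\<omega> \<in> space M. isolated_in_cell a b (X \<omega>) c}"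
    unfolding two by (auto simp: A_def B_def isolated_in_cell_def)
  moreover have "(\<lambda>\<omega>. card (X \<omega> \<inter> B 0)) -` A 0 \<inter> space M = {\<omega> \<in> space M. card (X \<omega> \<inter> core a b c) = 1}"
    by (auto simp: A_def B_def)
  moreover have "(\<lambda>\<omega>. card (X \<omega> \<inter> B 1)) -` A 1 \<inter> space M =
      {\<omega> \<in> space M. card (X \<omega> \<inter> (cell a b c - core a b c)) = 0}"
    by (auto simp: A_def B_def)
  moreover have "prob {\<omega> \<in> space M. card (X \<omega> \<inter> core a b c) = 1} = density * exp (- density)"
    by (subst count_poisson) (use borel_cell_sets in \<open>auto simp: measure_core\<close>)
  moreover have "prob {\<omega> \<in> space M. card (X \<omega> \<inter> (cell a b c - core a b c)) = 0} =
      exp (- (density * (3 ^ CARD('n) - 1)))"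
    by (subst count_poisson) (use borel_cell_sets in \<open>auto simp: measure_shell\<close>)
  ultimately show ?thesis
    by (simp add: two isolation_prob_def)
qed

lemma isolation_prob_le_1: "isolation_prob \<le> 1"
  using prob_isolated[of undefined] prob_le_1 by metis

text \<open>The counts in the cores (even indices) and shells (odd indices) of the cells are jointly
  independent. Grouping them into the pairs \<open>K j\<close> keeps independence, and pair
  \<open>j\<close> decides cell \<open>f j\<close>.\<close>

lemma indep_isolated:
  assumes "inj_on f {..<n :: nat}"
  shows "indep_vars (\<lambda>_. count_space UNIV) (\<lambda>j \<omega>. isolated_in_cell a b (X \<omega>) (f j)) {..<n}"
proof -
  define B where "B i = (if even i then core a b (f (i div 2))
    else cell a b (f (i div 2)) - core a b (f (i div 2)))" for i
  define K where "K j = {2 * j, Suc (2 * j)}" for j :: nat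
  define Y where "Y j g \<longleftrightarrow> g (2 * j) = (1 :: nat) \<and> g (Suc (2 * j)) = (0 :: nat)" for j :: nat and g
  have disj: "disjoint_family_on B {..<2 * n}"
    unfolding disjoint_family_on_def
  proof (intro ballI impI)
    fix i j assume ij: "i \<in> {..<2 * n}" "j \<in> {..<2 * n}" "i \<noteq> j"
    show "B i \<inter> B j = {}"
    proof (cases "i div 2 = j div 2")
      case True
      then have "even i \<noteq> even j"
        using ij(3) by presburger
      then show ?thesis by (auto simp: B_def True)
    next
      case False
      then have "f (i div 2) \<noteq> f (j div 2)"
        using inj_onD[OF assms, of "i div 2" "j div 2"] ij by (auto simp: less_mult_imp_div_less mult.commute)
      moreover have "B k \<subseteq> cell a b (f (k div 2))" for k
        using core_subset_cell[of a b "f (k div 2)"] by (auto simp: B_def)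
      ultimately show ?thesis
        using cells_disjoint[OF axes_distinct] by blast
    qed
  qed
  have "indep_vars (\<lambda>_. count_space UNIV) (\<lambda>i \<omega>. card (X \<omega> \<inter> B i)) {..<2 * n}"
    by (rule count_indep[OF _ disj]) (simp add: B_def borel_cell_sets)
  then have "indep_vars (\<lambda>j. PiM (K j) (\<lambda>_. count_space UNIV))
      (\<lambda>j \<omega>. restrict (\<lambda>i. card (X \<omega> \<inter> B i)) (K j)) {..<n}"
    by (rule indep_vars_restrict) (auto simp: K_def disjoint_family_on_def)
  then have "indep_vars (\<lambda>_. count_space UNIV)
      (\<lambda>j \<omega>. Y j (restrict (\<lambda>i. card (X \<omega> \<inter> B i)) (K j))) {..<n}"
  proof (rule indep_vars_compose2)
    show "Y j \<in> measurable (PiM (K j) (\<lambda>_. count_space UNIV)) (count_space UNIV)" for j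
    proof -
      have [measurable]: "(\<lambda>g. g i) \<in> measurable (PiM (K j) (\<lambda>_. count_space (UNIV :: nat set))) (count_space UNIV)"
        if "i \<in> K j" for i
        by (rule measurable_component_singleton[OF that])
      have [simp]: "2 * j \<in> K j" "Suc (2 * j) \<in> K j" by (auto simp: K_def)
      show ?thesis
        unfolding Y_def[abs_def] by measurable
    qed
  qed
  moreover have "Y j (restrict (\<lambda>i. card (X \<omega> \<inter> B i)) (K j)) = isolated_in_cell a b (X \<omega>) (f j)" for j \<omega>
    by (simp add: Y_def K_def B_def isolated_in_cell_def)
  ultimately show ?thesis by simp
qed

lemma prob_no_cell_isolated:
  assumes "finite F"
  shows "prob {\<omega> \<in> space M. \<forall>c\<in>F. \<not> isolated_in_cell a b (X \<omega>) c} = (1 - isolation_prob) ^ card F"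
proof (cases "F = {}")
  case True
  then show ?thesis by (simp add: prob_space)
next
  case False
  define n where "n = card F"
  obtain f where f: "bij_betw f {..<n} F"
    using ex_bij_betw_nat_finite[OF assms] by (auto simp: n_def lessThan_atLeast0)
  \<comment> \<open>The product rule for independent variables asks for a nonempty index set, hence
    the case distinction.\<close>
  have n: "{..<n} \<noteq> {}"
    using False assms by (simp add: n_def lessThan_empty_iff card_gt_0_iff)
  have "prob {\<omega> \<in> space M. \<forall>c\<in>F. \<not> isolated_in_cell a b (X \<omega>) c} =
      prob (\<Inter>j\<in>{..<n}. (\<lambda>\<omega>. isolated_in_cell a b (X \<omega>) (f j)) -` {False} \<inter> space M)"
    using n by (intro arg_cong[where f = prob]) (auto simp: bij_betw_imp_surj_on[OF f, symmetric])
  also have "\<dots> = (\<Prod>j\<in>{..<n}. prob ((\<lambda>\<omega>. isolated_in_cell a b (X \<omega>) (f j)) -` {False} \<inter> space M))"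
    by (rule indep_varsD[OF indep_isolated[OF bij_betw_imp_inj_on[OF f]] n]) auto
  also have "\<dots> = (\<Prod>j\<in>{..<n}. 1 - isolation_prob)"
  proof (rule prod.cong[OF refl])
    fix j
    have "(\<lambda>\<omega>. isolated_in_cell a b (X \<omega>) (f j)) -` {False} \<inter> space M =
        {\<omega> \<in> space M. \<not> isolated_in_cell a b (X \<omega>) (f j)}"
      by auto
    moreover have "prob {\<omega> \<in> space M. \<not> isolated_in_cell a b (X \<omega>) (f j)} = 1 - isolation_prob"
      unfolding prob_isolated[of "f j", symmetric] by (rule prob_neg) measurable
    ultimately show "prob ((\<lambda>\<omega>. isolated_in_cell a b (X \<omega>) (f j)) -` {False} \<inter> space M) = 1 - isolation_prob"
      by simp
  qed
  finally show ?thesis by (simp add: n_def)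
qed

end

subsection \<open>Percolation\<close>

text \<open>By symmetry of the edges, the component of a point can serve as the label in the
  renormalisation.\<close>

lemma component_eq_if_edge:
  assumes "(x, y) \<in> gn1_edges \<alpha> V"
  shows "component (gn1_edges \<alpha> V) x = component (gn1_edges \<alpha> V) y"
proof -
  have "(y, x) \<in> gn1_edges \<alpha> V"
    using assms sym_gn1_edges[of \<alpha> V] by (auto dest: symD)
  with assms show ?thesis
    unfolding component_def by (auto intro: converse_rtrancl_into_rtrancl)
qed

text \<open>The nearest-neighbour distance of \<open>x\<close> is an infimum over a set containing
  \<open>y\<close> and is at least 1, so the radius of \<open>x\<close> is at least
  \<open>\<alpha>\<close>.\<close>

lemma gn1_edge_if_isolated:
  assumes "x \<in> V" "y \<in> V" "x \<noteq> y" "0 \<le> \<alpha>" "dist x y \<le> \<alpha>"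
    and "\<And>z. z \<in> V \<Longrightarrow> z \<noteq> x \<Longrightarrow> 1 \<le> dist x z"
  shows "(x, y) \<in> gn1_edges \<alpha> V"
proof -
  have "1 \<le> nn_dist V x"
    unfolding nn_dist_def by (subst le_infdist_iff) (use assms in auto)
  then have "\<alpha> \<le> \<alpha> * nn_dist V x"
    using assms(4) mult_left_mono[of 1 "nn_dist V x" \<alpha>] by simp
  with assms show ?thesis
    by (auto simp: gn1_edges_def)
qed

text \<open>A site is a strip of \<open>N\<close> cells along axis \<open>a\<close>, one cell wide
  along axis \<open>b\<close>.\<close>

definition bad_site :: "'n \<Rightarrow> 'n \<Rightarrow> nat \<Rightarrow> (real ^ 'n) set \<Rightarrow> nat \<times> nat \<Rightarrow> bool" where
  "bad_site a b N V q \<longleftrightarrow> (\<forall>m<N. \<not> isolated_in_cell a b V (N * fst q + m, snd q))"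

text \<open>The label of a good site is the component of its chosen isolated point. Distinct good
  sites have distinct points, so an infinite cluster of sites yields an infinite component.\<close>

lemma infinite_component_if_boxes_good:
  fixes V :: "(real ^ 'n) set" and a b :: 'n
  assumes ab: "a \<noteq> b" and N: "0 < N"
    and fin: "\<And>B. bounded B \<Longrightarrow> finite (V \<inter> B)"
    and good: "\<And>n. \<not> bad_box (bad_site a b N V) n (0, 0)"
    and \<alpha>: "CARD('n) * (6 * real N + 3) \<le> \<alpha>"
  shows "has_infinite_component V (gn1_edges \<alpha> V)"
proof -
  let ?bad = "bad_site a b N V" and ?C = "component (gn1_edges \<alpha> V)"
  define P where "P q x \<longleftrightarrow> x \<in> V \<and> (\<forall>y\<in>V. y \<noteq> x \<longrightarrow> 1 \<le> dist x y) \<and>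
    (\<exists>m<N. x \<in> cell a b (N * fst q + m, snd q))" for q x
  define pt where "pt q = (SOME x. P q x)" for q
  have pt: "P q (pt q)" if q: "\<not> ?bad q" for q
  proof -
    from q obtain m where m: "m < N" "isolated_in_cell a b V (N * fst q + m, snd q)"
      by (auto simp: bad_site_def)
    from isolated_in_cellE[OF m(2) fin[OF bounded_cell]] m(1) have "\<exists>x. P q x"
      unfolding P_def by metis
    then show ?thesis
      unfolding pt_def by (rule someI_ex)
  qed
  have pt_V: "pt q \<in> V" if "\<not> ?bad q" for q
    using pt[OF that] by (simp add: P_def)
  have pt_inj: "q = q'" if q: "\<not> ?bad q" "\<not> ?bad q'" and eq: "pt q = pt q'" for q q'
  proof -
    obtain m m' where m: "m < N" "pt q \<in> cell a b (N * fst q + m, snd q)"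
        and m': "m' < N" "pt q' \<in> cell a b (N * fst q' + m', snd q')"
      using pt[OF q(1)] pt[OF q(2)] unfolding P_def by blast
    then have "(N * fst q + m, snd q) = (N * fst q' + m', snd q')"
      using cells_disjoint[OF ab] eq by (metis disjoint_iff)
    then have "N * fst q + m = N * fst q' + m'" "snd q = snd q'" by auto
    moreover have "(N * u + k) div N = u" if "k < N" for u k
      using that by simp
    from this[OF m(1), of "fst q"] this[OF m'(1), of "fst q'"] have "fst q = fst q'"
      using calculation(1) by metis
    ultimately show ?thesis
      by (simp add: prod_eq_iff)
  qed
  have adj: "?C (pt q) = ?C (pt q')"
    if q: "\<not> ?bad q" "\<not> ?bad q'" and ne: "q \<noteq> q'"
      and near: "fst q \<le> fst q'" "fst q' \<le> fst q + 1" "snd q \<le> snd q'" "snd q' \<le> snd q + 1" for q q'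
  proof -
    obtain m m' where m: "m < N" "pt q \<in> cell a b (N * fst q + m, snd q)"
        and m': "m' < N" "pt q' \<in> cell a b (N * fst q' + m', snd q')"
      using pt[OF q(1)] pt[OF q(2)] unfolding P_def by blast
    have "fst q' = fst q \<or> fst q' = Suc (fst q)" "snd q' = snd q \<or> snd q' = Suc (snd q)"
      using near by auto
    \<comment> \<open>Moving to the next site shifts the first index by at most \<open>N\<close>,
      and the positions within sites differ by less than \<open>N\<close>; the second index changes
      by at most 1.\<close>
    then have "\<bar>real (N * fst q + m) - real (N * fst q' + m')\<bar> \<le> 2 * real N"
        "\<bar>real (snd q) - real (snd q')\<bar> \<le> 2 * real N"
      using N m(1) m'(1) by (auto simp: algebra_simps)
    then have "dist (pt q) (pt q') \<le> CARD('n) * (3 * (2 * real N) + 3)"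
      using dist_cells_le[OF m(2) m'(2), of "2 * real N"] by simp
    also have "\<dots> \<le> \<alpha>" using \<alpha> by simp
    finally have "dist (pt q) (pt q') \<le> \<alpha>" .
    moreover have "0 \<le> \<alpha>"
      using zero_le_dist[of "pt q" "pt q'"] calculation by (rule order.trans)
    moreover have "pt q \<noteq> pt q'"
      using pt_inj q ne by blast
    ultimately have "(pt q, pt q') \<in> gn1_edges \<alpha> V"
      using pt[OF q(1)] pt_V[OF q(2)] by (intro gn1_edge_if_isolated) (auto simp: P_def)
    then show ?thesis by (rule component_eq_if_edge)
  qed
  have "infinite {q. \<not> ?bad q \<and> ?C (pt q) = ?C (pt (0, 0))}" (is "infinite ?Q")
    by (rule infinite_good_cluster[where b = ?bad and h = "\<lambda>q. ?C (pt q)"])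
       (use adj good in auto)
  moreover have "inj_on pt ?Q"
    using pt_inj by (auto intro: inj_onI)
  ultimately have "infinite (pt ` ?Q)"
    using finite_imageD by blast
  moreover have "pt ` ?Q \<subseteq> ?C (pt (0, 0))"
    by (auto simp: component_def)
  ultimately have "infinite (?C (pt (0, 0)))"
    using finite_subset by blast
  moreover have "pt (0, 0) \<in> V"
    using good[of 0] by (intro pt_V) simp
  ultimately show ?thesis
    unfolding has_infinite_component_def by blast
qed

section \<open>Choice of the scale and positive probability\<close>

context planar_poisson_cells
begin

text \<open>Division of the first cell index by \<open>N\<close> recovers the site, so the sites in
  \<open>D\<close> comprise \<open>N * card D\<close> distinct cells.\<close>

lemma prob_bad_sites:
  assumes N: "0 < N" and D: "finite D"
  shows "prob {\<omega> \<in> space M. \<forall>q\<in>D. bad_site a b N (X \<omega>) q} = ((1 - isolation_prob) ^ N) ^ card D"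
proof -
  define g where "g x = (N * fst (fst x) + snd x, snd (fst x))" for x :: "(nat \<times> nat) \<times> nat"
  have inj: "inj_on g (D \<times> {..<N})"
  proof (rule inj_onI)
    fix x y
    assume xy: "x \<in> D \<times> {..<N}" "y \<in> D \<times> {..<N}" "g x = g y"
    then have eq: "N * fst (fst x) + snd x = N * fst (fst y) + snd y" "snd (fst x) = snd (fst y)"
      by (auto simp: g_def)
    then have "(N * fst (fst x) + snd x) div N = (N * fst (fst y) + snd y) div N" by simp
    then have "fst (fst x) = fst (fst y)"
      using xy by auto
    with eq show "x = y"
      by (simp add: prod_eq_iff)
  qed
  have "{\<omega> \<in> space M. \<forall>q\<in>D. bad_site a b N (X \<omega>) q} =
      {\<omega> \<in> space M. \<forall>c\<in>g ` (D \<times> {..<N}). \<not> isolated_in_cell a b (X \<omega>) c}"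
    by (auto simp: bad_site_def g_def)
  moreover have "card (g ` (D \<times> {..<N})) = N * card D"
    using card_image[OF inj] by (simp add: card_cartesian_product)
  ultimately show ?thesis
    using prob_no_cell_isolated[of "g ` (D \<times> {..<N})"] D by (simp add: power_mult)
qed

lemma gn1_percolates: "\<exists>\<alpha>>0. 0 < prob (gn1_percolation_event M X \<alpha>)"
proof -
  \<comment> \<open>A site is bad with probability \<open>(1 - isolation_prob) ^ N\<close>, and 324
    is the threshold of the renormalisation. The bound also excludes \<open>N = 0\<close>, where the
    power is 1.\<close>
  have "\<exists>N. (1 - isolation_prob) ^ N < 1 / 324"
    using isolation_prob_pos by (intro real_arch_pow_inv) auto
  then obtain N where N_bound: "(1 - isolation_prob) ^ N < 1 / 324" by blast
  then have N: "0 < N" by (cases N) auto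
  define \<alpha> where "\<alpha> = CARD('n) * (6 * real N + 3)"
  have \<alpha>_pos: "0 < \<alpha>" by (simp add: \<alpha>_def add_nonneg_pos)
  let ?E = "gn1_percolation_event M X \<alpha>"
  \<comment> \<open>\<open>measure\<close> is 0 outside \<open>events\<close>, so a lower bound from
    the inclusion below requires measurability.\<close>
  have E: "?E \<in> events"
    by (rule gn1_percolation_event_in_events[OF \<alpha>_pos])
  have "{\<omega> \<in> space M. bad_site a b N (X \<omega>) q} \<in> events" for q
    unfolding bad_site_def by measurable
  then obtain U where U: "U \<in> events" "prob U < 1"
      "\<And>\<omega> n. \<omega> \<in> space M - U \<Longrightarrow> \<not> bad_box (bad_site a b N (X \<omega>)) n (0, 0)"
    using all_boxes_good_outside_event[of "\<lambda>\<omega>. bad_site a b N (X \<omega>)" "(1 - isolation_prob) ^ N"]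
      prob_bad_sites[OF N] N_bound isolation_prob_le_1 by auto
  have "space M - U \<subseteq> ?E"
    unfolding gn1_percolation_event_def
    using infinite_component_if_boxes_good[OF axes_distinct N locally_finite U(3), where \<alpha> = \<alpha>]
    by (auto simp: \<alpha>_def)
  then have "prob (space M - U) \<le> prob ?E"
    by (rule finite_measure_mono[OF _ E])
  then have "0 < prob ?E"
    using U(1,2) by (simp add: prob_compl)
  with \<alpha>_pos show ?thesis by blast
qed

end

theorem theorem4p1:
  fixes M :: "'w measure" and density :: real and X :: "'w \<Rightarrow> (real ^ 'n) set"
  assumes "CARD('n) \<ge> 2"
    and "homogeneous_poisson_process M density X"
  shows "gn1_critical_value M X < \<infinity>"
proof -
  have "\<not> CARD('n) \<le> Suc 0"
    using assms(1) by simp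
  \<comment> \<open>This is where dimension at least 2 enters: the layer of cells needs two distinct
    axes.\<close>
  then obtain a b :: 'n where "a \<noteq> b"
    unfolding card_le_Suc0_iff_eq[OF finite_class.finite_UNIV] by blast
  then interpret planar_poisson_cells M density X a b
    using assms(2) by (simp add: planar_poisson_cells_def planar_poisson_cells_axioms_def)
  obtain \<alpha> where "0 < \<alpha>" "0 < prob (gn1_percolation_event M X \<alpha>)"
    using gn1_percolates by blast
  then have "gn1_critical_value M X \<le> ereal \<alpha>"
    unfolding gn1_critical_value_def by (intro Inf_lower) auto
  then show ?thesis
    by (rule order.strict_trans1) simp
qed

end
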